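(* Let $\mathbf{C}$ be a quasitopos and let $\rho$ be a classifying PBPO$^+$ rule. If $G_L\Rightarrow^{\rho}_{(m,\alpha)}G_R$ and $G_L\Rightarrow^{\rho}_{(m,\beta)}G_R'$ are PBPO$^+$ steps with the same match $m$, then $\alpha=\beta$ and $G_R\cong G_R'$.
   Context: A quasitopos is a category with all finite limits and colimits that is locally cartesian closed and has a regular-subobject classifier. Its regular monos form a stable system of monics $\mathcal{M}$, and it has an $\mathcal{M}$-partial map classifier $(T,\eta)$: a functor $T$ and natural transformation $\eta:\mathrm{Id}\to T$ with each $\eta_X\in\mathcal{M}$ such that for every span $A\xleftarrow{m}X\xrightarrow{f}B$ with $m\in\mathcal{M}$ there is a unique $[m,f]:A\to T(B)$ making $\eta_B\circ f=[m,f]\circ m$ a pullback. A regular mono $t_L:L\to L'$ is a restricted classifier if there is a monomorphism $s:L'\to T(L)$ with $s\circ t_L=\eta_L$. PBPO$^+$ rule $\rho$: morphisms $l:K\to L$, $r:K\to R$, $t_L:L\to L'$, $t_K:K\to K'$, $l':K'\to L'$ with $t_L\circ l=l'\circ t_K$ a pullback. $\rho$ is classifying if $t_L$ is a regular mono that is a restricted classifier. PBPO$^+$ step $G_L\Rightarrow^{\rho}_{(m,\alpha)}G_R$ with $m:L\to G_L$, $\alpha:G_L\to L'$: $\alpha m=t_L$ and $L\xleftarrow{1_L}L\xrightarrow{m}G_L$ is a pullback of $L\xrightarrow{t_L}L'\xleftarrow{\alpha}G_L$; $G_L\xleftarrow{g_L}G_K\xrightarrow{u'}K'$ is a pullback of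 $\alpha,l'$; $u:K\to G_K$ is the unique morphism with $u'u=t_K$; $G_K\xrightarrow{g_R}G_R\xleftarrow{w}R$ is a pushout of $G_K\xleftarrow{u}K\xrightarrow{r}R$. *)

theory Defs
  imports Main
begin

section \<open>Categories\<close>

record ('o, 'm) category_data =
  Obj :: "'o set"
  Arr :: "'m set"
  Dom :: "'m \<Rightarrow> 'o"
  Cod :: "'m \<Rightarrow> 'o"
  Ide :: "'o \<Rightarrow> 'm"
  Comp :: "'m \<Rightarrow> 'm \<Rightarrow> 'm"  (infixr \<open>\<cdot>\<index>\<close> 70)

definition Hom :: "('o, 'm) category_data \<Rightarrow> 'o \<Rightarrow> 'o \<Rightarrow> 'm set"
  where "Hom C A B = {f \<in> Arr C. Dom C f = A \<and> Cod C f = B}"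

text \<open>Composition is in applicative order: \<open>g \<cdot> f\<close> is \<open>f\<close> followed by \<open>g\<close>. The values of
  the operations outside the carriers, and of \<open>g \<cdot> f\<close> for non-composable arrows,
  are unconstrained.\<close>

locale category =
  fixes C :: "('o, 'm) category_data" (structure)
  assumes Dom_Obj: "f \<in> Arr C \<Longrightarrow> Dom C f \<in> Obj C"
    and Cod_Obj: "f \<in> Arr C \<Longrightarrow> Cod C f \<in> Obj C"
    and Ide_Hom: "A \<in> Obj C \<Longrightarrow> Ide C A \<in> Hom C A A"
    and Comp_Hom: "\<lbrakk>f \<in> Hom C A B; g \<in> Hom C B D\<rbrakk> \<Longrightarrow> g \<cdot> f \<in> Hom C A D"
    and Comp_Ide: "f \<in> Hom C A B \<Longrightarrow> f \<cdot> Ide C A = f"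
    and Ide_Comp: "f \<in> Hom C A B \<Longrightarrow> Ide C B \<cdot> f = f"
    and Comp_assoc: "\<lbrakk>f \<in> Hom C A B; g \<in> Hom C B D; h \<in> Hom C D E\<rbrakk>
          \<Longrightarrow> (h \<cdot> g) \<cdot> f = h \<cdot> (g \<cdot> f)"

definition opposite :: "('o, 'm) category_data \<Rightarrow> ('o, 'm) category_data"
  where "opposite C =
    \<lparr>Obj = Obj C, Arr = Arr C, Dom = Cod C, Cod = Dom C, Ide = Ide C,
     Comp = (\<lambda>g f. f \<cdot>\<^bsub>C\<^esub> g)\<rparr>"

text \<open>An arrow of the slice category from \<open>a\<close> to \<open>b\<close> is a triple \<open>(a, h, b)\<close>, so that its
  domain and codomain can be recovered from it.\<close>

definition slice :: "('o, 'm) category_data \<Rightarrow> 'o \<Rightarrow> ('m, 'm \<times> 'm \<times> 'm) category_data"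
  where "slice C X =
    \<lparr>Obj = {a \<in> Arr C. Cod C a = X},
     Arr = {(a, h, b). a \<in> Arr C \<and> Cod C a = X \<and> b \<in> Arr C \<and> Cod C b = X \<and>
                       h \<in> Hom C (Dom C a) (Dom C b) \<and> b \<cdot>\<^bsub>C\<^esub> h = a},
     Dom = (\<lambda>(a, h, b). a),
     Cod = (\<lambda>(a, h, b). b),
     Ide = (\<lambda>a. (a, Ide C (Dom C a), a)),
     Comp = (\<lambda>(b, k, c) (a, h, b'). (a, k \<cdot>\<^bsub>C\<^esub> h, c))\<rparr>"

lemma opposite_simps [simp]:
  "Obj (opposite C) = Obj C" "Arr (opposite C) = Arr C"
  "Dom (opposite C) = Cod C" "Cod (opposite C) = Dom C"
  "Ide (opposite C) = Ide C" "g \<cdot>\<^bsub>opposite C\<^esub> f = f \<cdot>\<^bsub>C\<^esub> g"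
  "Hom (opposite C) A B = Hom C B A"
  by (auto simp: Hom_def opposite_def)

lemma (in category) category_opposite: "category (opposite C)"
  by unfold_locales (simp_all add: Dom_Obj Cod_Obj Ide_Hom Comp_Hom Comp_Ide Ide_Comp Comp_assoc)

lemma (in category) category_slice: "category (slice C X)"
proof
  fix f assume "f \<in> Arr (slice C X)"
  then show "Dom (slice C X) f \<in> Obj (slice C X)" "Cod (slice C X) f \<in> Obj (slice C X)"
    by (auto simp: slice_def)
next
  fix A assume "A \<in> Obj (slice C X)"
  then show "Ide (slice C X) A \<in> Hom (slice C X) A A"
    using Ide_Hom[of "Dom C A"] Comp_Ide[of A "Dom C A" X]
    by (auto simp: slice_def Hom_def Dom_Obj)
next
  fix f A B g D assume "f \<in> Hom (slice C X) A B" "g \<in> Hom (slice C X) B D"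
  then obtain h k where fg: "f = (A, h, B)" "g = (B, k, D)"
    and arr: "A \<in> Arr C" "B \<in> Arr C" "D \<in> Arr C" "Cod C A = X" "Cod C B = X" "Cod C D = X"
    and hk: "h \<in> Hom C (Dom C A) (Dom C B)" "k \<in> Hom C (Dom C B) (Dom C D)"
    and eq: "B \<cdot> h = A" "D \<cdot> k = B"
    by (auto simp: slice_def Hom_def)
  have "D \<in> Hom C (Dom C D) X" using arr by (auto simp: Hom_def)
  from Comp_assoc[OF hk this] eq have "D \<cdot> (k \<cdot> h) = A" by simp
  with fg arr hk Comp_Hom[OF hk] show "g \<cdot>\<^bsub>slice C X\<^esub> f \<in> Hom (slice C X) A D"
    by (auto simp: slice_def Hom_def)
next
  fix f A B assume "f \<in> Hom (slice C X) A B"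
  then show "f \<cdot>\<^bsub>slice C X\<^esub> Ide (slice C X) A = f" "Ide (slice C X) B \<cdot>\<^bsub>slice C X\<^esub> f = f"
    by (auto simp: slice_def Hom_def intro!: Comp_Ide Ide_Comp)
next
  fix f A B g D h E
  assume "f \<in> Hom (slice C X) A B" "g \<in> Hom (slice C X) B D" "h \<in> Hom (slice C X) D E"
  then show "(h \<cdot>\<^bsub>slice C X\<^esub> g) \<cdot>\<^bsub>slice C X\<^esub> f = h \<cdot>\<^bsub>slice C X\<^esub> (g \<cdot>\<^bsub>slice C X\<^esub> f)"
    by (auto simp: slice_def Hom_def intro!: Comp_assoc)
qed

definition monomorphism :: "('o, 'm) category_data \<Rightarrow> 'm \<Rightarrow> bool"
  where "monomorphism C f \<longleftrightarrow> f \<in> Arr C \<and>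
    (\<forall>A. \<forall>g \<in> Hom C A (Dom C f). \<forall>h \<in> Hom C A (Dom C f). f \<cdot>\<^bsub>C\<^esub> g = f \<cdot>\<^bsub>C\<^esub> h \<longrightarrow> g = h)"

definition isomorphic :: "('o, 'm) category_data \<Rightarrow> 'o \<Rightarrow> 'o \<Rightarrow> bool"
  where "isomorphic C A B \<longleftrightarrow> A \<in> Obj C \<and> B \<in> Obj C \<and>
    (\<exists>f \<in> Hom C A B. \<exists>g \<in> Hom C B A. g \<cdot>\<^bsub>C\<^esub> f = Ide C A \<and> f \<cdot>\<^bsub>C\<^esub> g = Ide C B)"

definition is_functor ::
  "('o1, 'm1) category_data \<Rightarrow> ('o2, 'm2) category_data \<Rightarrow> ('o1 \<Rightarrow> 'o2) \<Rightarrow> ('m1 \<Rightarrow> 'm2) \<Rightarrow> bool"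
  where "is_functor C D Fo Fm \<longleftrightarrow>
    (\<forall>A \<in> Obj C. Fo A \<in> Obj D) \<and>
    (\<forall>f \<in> Arr C. Fm f \<in> Hom D (Fo (Dom C f)) (Fo (Cod C f))) \<and>
    (\<forall>A \<in> Obj C. Fm (Ide C A) = Ide D (Fo A)) \<and>
    (\<forall>f \<in> Arr C. \<forall>g \<in> Arr C. Cod C f = Dom C g \<longrightarrow> Fm (g \<cdot>\<^bsub>C\<^esub> f) = Fm g \<cdot>\<^bsub>D\<^esub> Fm f)"

definition is_natural_transformation ::
  "('o1, 'm1) category_data \<Rightarrow> ('o2, 'm2) category_data \<Rightarrow>
   ('o1 \<Rightarrow> 'o2) \<Rightarrow> ('m1 \<Rightarrow> 'm2) \<Rightarrow> ('o1 \<Rightarrow> 'o2) \<Rightarrow> ('m1 \<Rightarrow> 'm2) \<Rightarrow> ('o1 \<Rightarrow> 'm2) \<Rightarrow> bool"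
  where "is_natural_transformation C D Fo Fm Go Gm \<tau> \<longleftrightarrow>
    (\<forall>A \<in> Obj C. \<tau> A \<in> Hom D (Fo A) (Go A)) \<and>
    (\<forall>f \<in> Arr C. Gm f \<cdot>\<^bsub>D\<^esub> \<tau> (Dom C f) = \<tau> (Cod C f) \<cdot>\<^bsub>D\<^esub> Fm f)"

section \<open>Limits and colimits\<close>

definition is_cone ::
  "('j, 'k) category_data \<Rightarrow> ('o, 'm) category_data \<Rightarrow> ('j \<Rightarrow> 'o) \<Rightarrow> ('k \<Rightarrow> 'm) \<Rightarrow>
   'o \<Rightarrow> ('j \<Rightarrow> 'm) \<Rightarrow> bool"
  where "is_cone J C Do Dm X \<kappa> \<longleftrightarrow> X \<in> Obj C \<and>
    (\<forall>j \<in> Obj J. \<kappa> j \<in> Hom C X (Do j)) \<and>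
    (\<forall>f \<in> Arr J. Dm f \<cdot>\<^bsub>C\<^esub> \<kappa> (Dom J f) = \<kappa> (Cod J f))"

definition is_limit ::
  "('j, 'k) category_data \<Rightarrow> ('o, 'm) category_data \<Rightarrow> ('j \<Rightarrow> 'o) \<Rightarrow> ('k \<Rightarrow> 'm) \<Rightarrow>
   'o \<Rightarrow> ('j \<Rightarrow> 'm) \<Rightarrow> bool"
  where "is_limit J C Do Dm X \<kappa> \<longleftrightarrow> is_cone J C Do Dm X \<kappa> \<and>
    (\<forall>Y \<mu>. is_cone J C Do Dm Y \<mu> \<longrightarrow>
       (\<exists>!h. h \<in> Hom C Y X \<and> (\<forall>j \<in> Obj J. \<kappa> j \<cdot>\<^bsub>C\<^esub> h = \<mu> j)))"

definition is_colimit ::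
  "('j, 'k) category_data \<Rightarrow> ('o, 'm) category_data \<Rightarrow> ('j \<Rightarrow> 'o) \<Rightarrow> ('k \<Rightarrow> 'm) \<Rightarrow>
   'o \<Rightarrow> ('j \<Rightarrow> 'm) \<Rightarrow> bool"
  where "is_colimit J C Do Dm X \<kappa> \<longleftrightarrow> is_limit (opposite J) (opposite C) Do Dm X \<kappa>"

text \<open>Every finite category is isomorphic to one whose objects and arrows are natural
  numbers, so the shapes of type \<open>(nat, nat) category_data\<close> cover all finite diagrams.\<close>

definition finite_category :: "(nat, nat) category_data \<Rightarrow> bool"
  where "finite_category J \<longleftrightarrow> category J \<and> finite (Obj J) \<and> finite (Arr J)"

definition has_finite_limits :: "('o, 'm) category_data \<Rightarrow> bool"
  where "has_finite_limits C \<longleftrightarrow>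
    (\<forall>J Do Dm. finite_category J \<and> is_functor J C Do Dm \<longrightarrow> (\<exists>X \<kappa>. is_limit J C Do Dm X \<kappa>))"

definition has_finite_colimits :: "('o, 'm) category_data \<Rightarrow> bool"
  where "has_finite_colimits C \<longleftrightarrow>
    (\<forall>J Do Dm. finite_category J \<and> is_functor J C Do Dm \<longrightarrow> (\<exists>X \<kappa>. is_colimit J C Do Dm X \<kappa>))"

text \<open>\<open>is_pullback C f g p q\<close>: the span \<open>(p, q)\<close> is a pullback of the cospan \<open>(f, g)\<close>,
  where \<open>f \<cdot> p = g \<cdot> q\<close>.\<close>

definition is_pullback :: "('o, 'm) category_data \<Rightarrow> 'm \<Rightarrow> 'm \<Rightarrow> 'm \<Rightarrow> 'm \<Rightarrow> bool"
  where "is_pullback C f g p q \<longleftrightarrow>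
    f \<in> Arr C \<and> g \<in> Arr C \<and> Cod C f = Cod C g \<and>
    p \<in> Hom C (Dom C p) (Dom C f) \<and> q \<in> Hom C (Dom C p) (Dom C g) \<and>
    f \<cdot>\<^bsub>C\<^esub> p = g \<cdot>\<^bsub>C\<^esub> q \<and>
    (\<forall>Y. \<forall>a \<in> Hom C Y (Dom C f). \<forall>b \<in> Hom C Y (Dom C g). f \<cdot>\<^bsub>C\<^esub> a = g \<cdot>\<^bsub>C\<^esub> b \<longrightarrow>
       (\<exists>!h. h \<in> Hom C Y (Dom C p) \<and> p \<cdot>\<^bsub>C\<^esub> h = a \<and> q \<cdot>\<^bsub>C\<^esub> h = b))"

text \<open>\<open>is_pushout C f g p q\<close>: the cospan \<open>(p, q)\<close> is a pushout of the span \<open>(f, g)\<close>,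
  where \<open>p \<cdot> f = q \<cdot> g\<close>.\<close>

definition is_pushout :: "('o, 'm) category_data \<Rightarrow> 'm \<Rightarrow> 'm \<Rightarrow> 'm \<Rightarrow> 'm \<Rightarrow> bool"
  where "is_pushout C f g p q \<longleftrightarrow> is_pullback (opposite C) f g p q"

lemma is_pushout_iff:
  "is_pushout C f g p q \<longleftrightarrow>
    f \<in> Arr C \<and> g \<in> Arr C \<and> Dom C f = Dom C g \<and>
    p \<in> Hom C (Cod C f) (Cod C p) \<and> q \<in> Hom C (Cod C g) (Cod C p) \<and>
    p \<cdot>\<^bsub>C\<^esub> f = q \<cdot>\<^bsub>C\<^esub> g \<and>
    (\<forall>Y. \<forall>a \<in> Hom C (Cod C f) Y. \<forall>b \<in> Hom C (Cod C g) Y. a \<cdot>\<^bsub>C\<^esub> f = b \<cdot>\<^bsub>C\<^esub> g \<longrightarrow>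
       (\<exists>!h. h \<in> Hom C (Cod C p) Y \<and> h \<cdot>\<^bsub>C\<^esub> p = a \<and> h \<cdot>\<^bsub>C\<^esub> q = b))"
  by (simp add: is_pushout_def is_pullback_def)

definition is_equalizer :: "('o, 'm) category_data \<Rightarrow> 'm \<Rightarrow> 'm \<Rightarrow> 'm \<Rightarrow> bool"
  where "is_equalizer C f g e \<longleftrightarrow>
    f \<in> Arr C \<and> g \<in> Hom C (Dom C f) (Cod C f) \<and> e \<in> Hom C (Dom C e) (Dom C f) \<and>
    f \<cdot>\<^bsub>C\<^esub> e = g \<cdot>\<^bsub>C\<^esub> e \<and>
    (\<forall>Y. \<forall>a \<in> Hom C Y (Dom C f). f \<cdot>\<^bsub>C\<^esub> a = g \<cdot>\<^bsub>C\<^esub> a \<longrightarrow>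
       (\<exists>!h. h \<in> Hom C Y (Dom C e) \<and> e \<cdot>\<^bsub>C\<^esub> h = a))"

definition regular_mono :: "('o, 'm) category_data \<Rightarrow> 'm \<Rightarrow> bool"
  where "regular_mono C e \<longleftrightarrow> (\<exists>f g. is_equalizer C f g e)"

definition is_terminal :: "('o, 'm) category_data \<Rightarrow> 'o \<Rightarrow> bool"
  where "is_terminal C U \<longleftrightarrow> U \<in> Obj C \<and> (\<forall>A \<in> Obj C. \<exists>!f. f \<in> Hom C A U)"

definition is_product :: "('o, 'm) category_data \<Rightarrow> 'o \<Rightarrow> 'o \<Rightarrow> 'o \<Rightarrow> 'm \<Rightarrow> 'm \<Rightarrow> bool"
  where "is_product C A B P p q \<longleftrightarrow>
    P \<in> Obj C \<and> p \<in> Hom C P A \<and> q \<in> Hom C P B \<and>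
    (\<forall>Y. \<forall>a \<in> Hom C Y A. \<forall>b \<in> Hom C Y B.
       \<exists>!h. h \<in> Hom C Y P \<and> p \<cdot>\<^bsub>C\<^esub> h = a \<and> q \<cdot>\<^bsub>C\<^esub> h = b)"

section \<open>Quasitoposes\<close>

text \<open>\<open>E\<close> with \<open>ev : P \<rightarrow> Z\<close>, where \<open>(P, p, q)\<close> is a product of \<open>E\<close> and \<open>B\<close>, is an exponential
  of \<open>Z\<close> by \<open>B\<close>. The arrow \<open>k\<close> below is the (unique) arrow \<open>h \<times> 1\<^sub>B\<close>.\<close>

definition is_exponential ::
  "('o, 'm) category_data \<Rightarrow> 'o \<Rightarrow> 'o \<Rightarrow> 'o \<Rightarrow> 'o \<Rightarrow> 'm \<Rightarrow> 'm \<Rightarrow> 'm \<Rightarrow> bool"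
  where "is_exponential C B Z E P p q ev \<longleftrightarrow>
    is_product C E B P p q \<and> ev \<in> Hom C P Z \<and>
    (\<forall>A Q p' q'. is_product C A B Q p' q' \<longrightarrow>
       (\<forall>g \<in> Hom C Q Z. \<exists>!h. h \<in> Hom C A E \<and>
          (\<exists>k \<in> Hom C Q P. p \<cdot>\<^bsub>C\<^esub> k = h \<cdot>\<^bsub>C\<^esub> p' \<and> q \<cdot>\<^bsub>C\<^esub> k = q' \<and> ev \<cdot>\<^bsub>C\<^esub> k = g)))"

definition cartesian_closed :: "('o, 'm) category_data \<Rightarrow> bool"
  where "cartesian_closed C \<longleftrightarrow>
    (\<exists>U. is_terminal C U) \<and>
    (\<forall>A \<in> Obj C. \<forall>B \<in> Obj C. \<exists>P p q. is_product C A B P p q) \<and>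
    (\<forall>B \<in> Obj C. \<forall>Z \<in> Obj C. \<exists>E P p q ev. is_exponential C B Z E P p q ev)"

definition locally_cartesian_closed :: "('o, 'm) category_data \<Rightarrow> bool"
  where "locally_cartesian_closed C \<longleftrightarrow> (\<forall>X \<in> Obj C. cartesian_closed (slice C X))"

definition is_regular_subobject_classifier ::
  "('o, 'm) category_data \<Rightarrow> 'o \<Rightarrow> 'o \<Rightarrow> 'm \<Rightarrow> bool"
  where "is_regular_subobject_classifier C U \<Omega> tr \<longleftrightarrow>
    is_terminal C U \<and> tr \<in> Hom C U \<Omega> \<and>
    (\<forall>m. regular_mono C m \<longrightarrow>
       (\<exists>!\<chi>. \<chi> \<in> Hom C (Cod C m) \<Omega> \<and>
          (\<exists>t \<in> Hom C (Dom C m) U. is_pullback C tr \<chi> t m)))"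

locale quasitopos = category +
  assumes finite_limits: "has_finite_limits C"
    and finite_colimits: "has_finite_colimits C"
    and lcc: "locally_cartesian_closed C"
    and classifier: "\<exists>U \<Omega> tr. is_regular_subobject_classifier C U \<Omega> tr"

text \<open>A classifier of partial maps with domain of definition in \<open>M\<close>. The functor \<open>T\<close> is
  given by its object part \<open>To\<close> and its arrow part \<open>Tm\<close>.\<close>

definition is_partial_map_classifier ::
  "('o, 'm) category_data \<Rightarrow> 'm set \<Rightarrow> ('o \<Rightarrow> 'o) \<Rightarrow> ('m \<Rightarrow> 'm) \<Rightarrow> ('o \<Rightarrow> 'm) \<Rightarrow> bool"
  where "is_partial_map_classifier C M To Tm \<eta> \<longleftrightarrow>
    is_functor C C To Tm \<and>
    is_natural_transformation C C (\<lambda>A. A) (\<lambda>f. f) To Tm \<eta> \<and>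
    (\<forall>A \<in> Obj C. \<eta> A \<in> M) \<and>
    (\<forall>m f A X B. m \<in> M \<and> m \<in> Hom C X A \<and> f \<in> Hom C X B \<longrightarrow>
       (\<exists>!h. h \<in> Hom C A (To B) \<and> is_pullback C (\<eta> B) h f m))"

definition restricted_classifier ::
  "('o, 'm) category_data \<Rightarrow> ('o \<Rightarrow> 'o) \<Rightarrow> ('o \<Rightarrow> 'm) \<Rightarrow> 'm \<Rightarrow> bool"
  where "restricted_classifier C To \<eta> t \<longleftrightarrow> regular_mono C t \<and>
    (\<exists>s \<in> Hom C (Cod C t) (To (Dom C t)). monomorphism C s \<and> s \<cdot>\<^bsub>C\<^esub> t = \<eta> (Dom C t))"

section \<open>PBPO\<open>\<^sup>+\<close> rewriting\<close>

record ('o, 'm) pbpo_rule =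
  objL :: 'o
  objK :: 'o
  objR :: 'o
  objL' :: 'o
  objK' :: 'o
  arrl :: 'm
  arrr :: 'm
  typL :: 'm
  typK :: 'm
  arrl' :: 'm

definition is_pbpo_plus_rule :: "('o, 'm) category_data \<Rightarrow> ('o, 'm) pbpo_rule \<Rightarrow> bool"
  where "is_pbpo_plus_rule C \<rho> \<longleftrightarrow>
    arrl \<rho> \<in> Hom C (objK \<rho>) (objL \<rho>) \<and>
    arrr \<rho> \<in> Hom C (objK \<rho>) (objR \<rho>) \<and>
    typL \<rho> \<in> Hom C (objL \<rho>) (objL' \<rho>) \<and>
    typK \<rho> \<in> Hom C (objK \<rho>) (objK' \<rho>) \<and>
    arrl' \<rho> \<in> Hom C (objK' \<rho>) (objL' \<rho>) \<and>
    is_pullback C (typL \<rho>) (arrl' \<rho>) (arrl \<rho>) (typK \<rho>)"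

definition classifying ::
  "('o, 'm) category_data \<Rightarrow> ('o \<Rightarrow> 'o) \<Rightarrow> ('o \<Rightarrow> 'm) \<Rightarrow> ('o, 'm) pbpo_rule \<Rightarrow> bool"
  where "classifying C To \<eta> \<rho> \<longleftrightarrow> regular_mono C (typL \<rho>) \<and> restricted_classifier C To \<eta> (typL \<rho>)"

definition is_pbpo_plus_step ::
  "('o, 'm) category_data \<Rightarrow> ('o, 'm) pbpo_rule \<Rightarrow> 'o \<Rightarrow> 'm \<Rightarrow> 'm \<Rightarrow> 'o \<Rightarrow> bool"
  where "is_pbpo_plus_step C \<rho> GL m \<alpha> GR \<longleftrightarrow>
    m \<in> Hom C (objL \<rho>) GL \<and> \<alpha> \<in> Hom C GL (objL' \<rho>) \<and>
    \<alpha> \<cdot>\<^bsub>C\<^esub> m = typL \<rho> \<and>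
    is_pullback C (typL \<rho>) \<alpha> (Ide C (objL \<rho>)) m \<and>
    (\<exists>GK gL u' u gR w.
       gL \<in> Hom C GK GL \<and> u' \<in> Hom C GK (objK' \<rho>) \<and>
       is_pullback C \<alpha> (arrl' \<rho>) gL u' \<and>
       u \<in> Hom C (objK \<rho>) GK \<and> u' \<cdot>\<^bsub>C\<^esub> u = typK \<rho> \<and>
       (\<forall>v \<in> Hom C (objK \<rho>) GK. u' \<cdot>\<^bsub>C\<^esub> v = typK \<rho> \<longrightarrow> v = u) \<and>
       gR \<in> Hom C GK GR \<and> w \<in> Hom C (objR \<rho>) GR \<and>
       is_pushout C u (arrr \<rho>) gR w)"

end

theory Submission
  imports Defs
begin

text \<open>The match square exhibits \<open>m\<close> as a pullback of the regular mono \<open>t\<^sub>L\<close>, so \<open>m\<close> is a regular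
  mono. Composing with the mono \<open>s : L' \<rightarrow> T(L)\<close> keeps it a pullback, now of \<open>\<eta>\<^sub>L\<close> along
  \<open>s \<cdot> \<alpha>\<close>; hence \<open>s \<cdot> \<alpha>\<close> is the classifying arrow of the partial map \<open>(m, 1\<^sub>L)\<close>, and so is
  \<open>s \<cdot> \<beta>\<close>. Thus \<open>s \<cdot> \<alpha> = s \<cdot> \<beta>\<close> and \<open>\<alpha> = \<beta>\<close>. The two steps then only differ in the choice of a
  pullback and of a pushout.\<close>

lemma HomD: "f \<in> Hom C A B \<Longrightarrow> f \<in> Arr C" "f \<in> Hom C A B \<Longrightarrow> Dom C f = A"
  "f \<in> Hom C A B \<Longrightarrow> Cod C f = B"
  by (auto simp: Hom_def)

lemma is_pullback_comm:
  assumes "is_pullback C f g p q"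
  shows "p \<in> Hom C (Dom C p) (Dom C f)" "q \<in> Hom C (Dom C p) (Dom C g)" "f \<cdot>\<^bsub>C\<^esub> p = g \<cdot>\<^bsub>C\<^esub> q"
  using assms by (auto simp: is_pullback_def)

lemma is_pullback_ex1:
  assumes "is_pullback C f g p q" "a \<in> Hom C Y (Dom C f)" "b \<in> Hom C Y (Dom C g)"
    and "f \<cdot>\<^bsub>C\<^esub> a = g \<cdot>\<^bsub>C\<^esub> b"
  shows "\<exists>!h. h \<in> Hom C Y (Dom C p) \<and> p \<cdot>\<^bsub>C\<^esub> h = a \<and> q \<cdot>\<^bsub>C\<^esub> h = b"
  using assms by (simp add: is_pullback_def)

lemma isomorphic_opposite [simp]: "isomorphic (opposite C) A B = isomorphic C A B"
  by (auto simp: isomorphic_def)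

context category
begin

lemma pullback_jointly_monic:
  assumes pb: "is_pullback C f g p q"
    and h: "h \<in> Hom C Y (Dom C p)" and k: "k \<in> Hom C Y (Dom C p)"
    and "p \<cdot> h = p \<cdot> k" "q \<cdot> h = q \<cdot> k"
  shows "h = k"
proof -
  note pq = is_pullback_comm[OF pb]
  have fg: "f \<in> Hom C (Dom C f) (Cod C f)" "g \<in> Hom C (Dom C g) (Cod C f)"
    using pb by (auto simp: is_pullback_def Hom_def)
  have "f \<cdot> (p \<cdot> k) = g \<cdot> (q \<cdot> k)"
    using Comp_assoc[OF k pq(1) fg(1)] Comp_assoc[OF k pq(2) fg(2)] pq(3) by simp
  from is_pullback_ex1[OF pb Comp_Hom[OF k pq(1)] Comp_Hom[OF k pq(2)] this]
  show ?thesis using assms by blast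
qed

text \<open>The usual comparison of two universal cones, by joint monicity of the legs. Stated with
  \<open>obtains\<close> because \<open>step_result_unique\<close> needs the compatibility
  \<open>q' \<cdot> \<phi> = q\<close>, which \<open>isomorphic\<close> forgets.\<close>

lemma pullback_iso:
  assumes P: "is_pullback C f g p q" and P': "is_pullback C f g p' q'"
  obtains \<phi> \<psi> where "\<phi> \<in> Hom C (Dom C p) (Dom C p')" "\<psi> \<in> Hom C (Dom C p') (Dom C p)"
    and "\<psi> \<cdot> \<phi> = Ide C (Dom C p)" "\<phi> \<cdot> \<psi> = Ide C (Dom C p')"
    and "p' \<cdot> \<phi> = p" "q' \<cdot> \<phi> = q"
proof -
  note c = is_pullback_comm[OF P] and c' = is_pullback_comm[OF P']
  obtain \<phi> where \<phi>: "\<phi> \<in> Hom C (Dom C p) (Dom C p')" "p' \<cdot> \<phi> = p" "q' \<cdot> \<phi> = q"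
    using is_pullback_ex1[OF P' c] by blast
  obtain \<psi> where \<psi>: "\<psi> \<in> Hom C (Dom C p') (Dom C p)" "p \<cdot> \<psi> = p'" "q \<cdot> \<psi> = q'"
    using is_pullback_ex1[OF P c'] by blast
  have obj: "Dom C p \<in> Obj C" "Dom C p' \<in> Obj C"
    using c(1) c'(1) by (auto intro!: Dom_Obj simp: HomD(1))
  have "\<psi> \<cdot> \<phi> = Ide C (Dom C p)"
    using Comp_assoc[OF \<phi>(1) \<psi>(1) c(1)] Comp_assoc[OF \<phi>(1) \<psi>(1) c(2)] \<phi> \<psi>
    by (intro pullback_jointly_monic[OF P Comp_Hom[OF \<phi>(1) \<psi>(1)] Ide_Hom[OF obj(1)]])
      (simp_all add: Comp_Ide[OF c(1)] Comp_Ide[OF c(2)])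
  moreover have "\<phi> \<cdot> \<psi> = Ide C (Dom C p')"
    using Comp_assoc[OF \<psi>(1) \<phi>(1) c'(1)] Comp_assoc[OF \<psi>(1) \<phi>(1) c'(2)] \<phi> \<psi>
    by (intro pullback_jointly_monic[OF P' Comp_Hom[OF \<psi>(1) \<phi>(1)] Ide_Hom[OF obj(2)]])
      (simp_all add: Comp_Ide[OF c'(1)] Comp_Ide[OF c'(2)])
  ultimately show ?thesis using that \<phi> \<psi> by blast
qed

lemma pullback_isomorphic:
  assumes P: "is_pullback C f g p q" and P': "is_pullback C f g p' q'"
  shows "isomorphic C (Dom C p) (Dom C p')"
proof -
  have "Dom C p \<in> Obj C" "Dom C p' \<in> Obj C"
    using is_pullback_comm(1)[OF P] is_pullback_comm(1)[OF P'] by (auto intro!: Dom_Obj simp: HomD(1))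
  with pullback_iso[OF P P'] show ?thesis
    unfolding isomorphic_def by metis
qed

text \<open>Duality: a pushout is a pullback in \<open>opposite C\<close>, and inverse pairs are the
  same in both categories.\<close>

lemma pushout_isomorphic:
  assumes "is_pushout C f g p q" and "is_pushout C f g p' q'"
  shows "isomorphic C (Cod C p) (Cod C p')"
  using category.pullback_isomorphic[OF category_opposite assms[unfolded is_pushout_def]] by simp

text \<open>Cocones under the spans \<open>(u, r)\<close> and \<open>(\<phi> \<cdot> u, r)\<close>
  correspond by composing the first leg with \<open>\<psi>\<close> or \<open>\<phi>\<close>. This
  moves the pushout of one rewriting step onto the span of another.\<close>

lemma pushout_precomp_iso:
  assumes po: "is_pushout C (\<phi> \<cdot> u) r g w"
    and \<phi>: "\<phi> \<in> Hom C A B" and \<psi>: "\<psi> \<in> Hom C B A"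
    and inv: "\<psi> \<cdot> \<phi> = Ide C A" "\<phi> \<cdot> \<psi> = Ide C B"
    and u: "u \<in> Hom C K A"
  shows "is_pushout C u r (g \<cdot> \<phi>) w"
proof -
  note H = HomD[OF u] HomD[OF Comp_Hom[OF u \<phi>]]
  have r: "r \<in> Hom C K (Cod C r)" and g: "g \<in> Hom C B (Cod C g)"
    and w: "w \<in> Hom C (Cod C r) (Cod C g)" and eq: "g \<cdot> (\<phi> \<cdot> u) = w \<cdot> r"
    using po by (auto simp: is_pushout_iff H Hom_def)
  have univ: "\<exists>!h. h \<in> Hom C (Cod C g) Y \<and> h \<cdot> g = a \<and> h \<cdot> w = b"
    if "a \<in> Hom C B Y" "b \<in> Hom C (Cod C r) Y" "a \<cdot> (\<phi> \<cdot> u) = b \<cdot> r" for a b Y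
    using po that by (simp add: is_pushout_iff H)
  have g\<phi>: "g \<cdot> \<phi> \<in> Hom C A (Cod C g)" by (rule Comp_Hom[OF \<phi> g])
  have "\<exists>!h. h \<in> Hom C (Cod C g) Y \<and> h \<cdot> (g \<cdot> \<phi>) = a \<and> h \<cdot> w = b"
    if a: "a \<in> Hom C A Y" and b: "b \<in> Hom C (Cod C r) Y" and ab: "a \<cdot> u = b \<cdot> r" for a b Y
  proof -
    \<comment> \<open>The cocone \<open>(a, b)\<close> is transported to
      \<open>(a \<cdot> \<psi>, b)\<close>, to which the given pushout applies.\<close>
    have "a \<cdot> \<psi> \<cdot> \<phi> \<cdot> u = b \<cdot> r"
      using Comp_assoc[OF u \<phi> \<psi>] Ide_Comp[OF u] inv ab by simp
    then have "(a \<cdot> \<psi>) \<cdot> (\<phi> \<cdot> u) = b \<cdot> r"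
      using Comp_assoc[OF Comp_Hom[OF u \<phi>] \<psi> a] by simp
    note ex1 = univ[OF Comp_Hom[OF \<psi> a] b this]
    \<comment> \<open>Invertibility of \<open>\<phi>\<close> makes the two factorization problems
      equivalent, so existence and uniqueness transfer together.\<close>
    have "h \<cdot> (g \<cdot> \<phi>) = a \<longleftrightarrow> h \<cdot> g = a \<cdot> \<psi>" if h: "h \<in> Hom C (Cod C g) Y" for h
    proof
      assume "h \<cdot> (g \<cdot> \<phi>) = a"
      then have "(h \<cdot> g) \<cdot> \<phi> = a"
        using Comp_assoc[OF \<phi> g h] by simp
      then have "a \<cdot> \<psi> = (h \<cdot> g) \<cdot> \<phi> \<cdot> \<psi>"
        using Comp_assoc[OF \<psi> \<phi> Comp_Hom[OF g h]] by simp
      then show "h \<cdot> g = a \<cdot> \<psi>"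
        using inv Comp_Ide[OF Comp_Hom[OF g h]] by simp
    next
      assume "h \<cdot> g = a \<cdot> \<psi>"
      then show "h \<cdot> (g \<cdot> \<phi>) = a"
        using Comp_assoc[OF \<phi> g h] Comp_assoc[OF \<phi> \<psi> a] inv Comp_Ide[OF a] by metis
    qed
    then have "(\<lambda>h. h \<in> Hom C (Cod C g) Y \<and> h \<cdot> (g \<cdot> \<phi>) = a \<and> h \<cdot> w = b) =
        (\<lambda>h. h \<in> Hom C (Cod C g) Y \<and> h \<cdot> g = a \<cdot> \<psi> \<and> h \<cdot> w = b)"
      by blast
    with ex1 show ?thesis by simp
  qed
  moreover have "(g \<cdot> \<phi>) \<cdot> u = w \<cdot> r"
    using Comp_assoc[OF u \<phi> g] eq by simp
  ultimately show ?thesis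
    using g\<phi> w by (simp add: is_pushout_iff HomD[OF u] HomD(1,2)[OF r] HomD[OF g\<phi>])
qed

text \<open>If \<open>t\<close> equalizes \<open>f\<close> and \<open>g\<close>, then its pullback
  \<open>m\<close> along \<open>\<alpha>\<close> equalizes \<open>f \<cdot> \<alpha>\<close> and
  \<open>g \<cdot> \<alpha>\<close>. This makes a match eligible for the partial map
  classifier.\<close>

lemma regular_mono_pullback:
  assumes pb: "is_pullback C t \<alpha> p m" and t: "regular_mono C t"
  shows "regular_mono C m"
proof -
  note c = is_pullback_comm[OF pb]
  \<comment> \<open>The apex is \<open>Dom C p\<close> in \<open>is_pullback\<close> but must be
    \<open>Dom C m\<close> in \<open>is_equalizer\<close>; the typing of \<open>m\<close> identifies
    the two.\<close>
  have m: "m \<in> Hom C (Dom C m) (Dom C \<alpha>)" and p: "p \<in> Hom C (Dom C m) (Dom C t)"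
    using c by (simp_all add: HomD(2)[OF c(2)])
  from t obtain f g where e: "is_equalizer C f g t"
    unfolding regular_mono_def by blast
  have t': "t \<in> Hom C (Dom C t) (Dom C f)" and \<alpha>: "\<alpha> \<in> Hom C (Dom C \<alpha>) (Dom C f)"
    and f: "f \<in> Hom C (Dom C f) (Cod C f)" and g: "g \<in> Hom C (Dom C f) (Cod C f)"
    and ft: "f \<cdot> t = g \<cdot> t"
    using e pb by (auto simp: is_equalizer_def is_pullback_def Hom_def)
  have "(f \<cdot> \<alpha>) \<cdot> m = (g \<cdot> \<alpha>) \<cdot> m"
    using Comp_assoc[OF m \<alpha> f] Comp_assoc[OF m \<alpha> g] c(3) ft
      Comp_assoc[OF p t' f] Comp_assoc[OF p t' g] by simp
  moreover have "\<exists>!h. h \<in> Hom C Y (Dom C m) \<and> m \<cdot> h = a"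
    if a: "a \<in> Hom C Y (Dom C \<alpha>)" and eq: "(f \<cdot> \<alpha>) \<cdot> a = (g \<cdot> \<alpha>) \<cdot> a" for Y a
  proof -
    have "f \<cdot> (\<alpha> \<cdot> a) = g \<cdot> (\<alpha> \<cdot> a)"
      using eq Comp_assoc[OF a \<alpha> f] Comp_assoc[OF a \<alpha> g] by simp
    then have ex1: "\<exists>!h. h \<in> Hom C Y (Dom C t) \<and> t \<cdot> h = \<alpha> \<cdot> a"
      using e Comp_Hom[OF a \<alpha>] by (simp add: is_equalizer_def)
    then obtain k where k: "k \<in> Hom C Y (Dom C t)" "t \<cdot> k = \<alpha> \<cdot> a" by blast
    \<comment> \<open>The equalizer property constrains only \<open>m \<cdot> h\<close>. The other
      pullback equation is then automatic, since \<open>\<alpha> \<cdot> a\<close> factors through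
      \<open>t\<close> in only one way.\<close>
    have "p \<cdot> h = k" if h: "h \<in> Hom C Y (Dom C m)" "m \<cdot> h = a" for h
    proof -
      have "t \<cdot> (p \<cdot> h) = \<alpha> \<cdot> a"
        using Comp_assoc[OF h(1) p t'] Comp_assoc[OF h(1) m \<alpha>] c(3) h(2) by simp
      with Comp_Hom[OF h(1) p] k ex1 show ?thesis by blast
    qed
    moreover have "\<exists>!h. h \<in> Hom C Y (Dom C m) \<and> p \<cdot> h = k \<and> m \<cdot> h = a"
      using is_pullback_ex1[OF pb k(1) a k(2)] HomD(2)[OF c(2)] by simp
    ultimately show ?thesis by blast
  qed
  ultimately have "is_equalizer C (f \<cdot> \<alpha>) (g \<cdot> \<alpha>) m"
    using m Comp_Hom[OF \<alpha> f] Comp_Hom[OF \<alpha> g]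
    by (simp add: is_equalizer_def HomD[OF Comp_Hom[OF \<alpha> f]])
  then show ?thesis unfolding regular_mono_def by blast
qed

lemma monomorphism_cancel:
  assumes "monomorphism C s" "s \<in> Hom C B D" "g \<in> Hom C A B" "h \<in> Hom C A B" "s \<cdot> g = s \<cdot> h"
  shows "g = h"
  using assms by (auto simp: monomorphism_def HomD)

text \<open>Cancelling the mono \<open>s\<close> shows that both cospans admit the same commuting
  squares, hence the same universal ones.\<close>

lemma pullback_postcomp_mono:
  assumes pb: "is_pullback C t \<alpha> p m"
    and t: "t \<in> Hom C L B" and \<alpha>: "\<alpha> \<in> Hom C G B"
    and s: "monomorphism C s" "s \<in> Hom C B D"
  shows "is_pullback C (s \<cdot> t) (s \<cdot> \<alpha>) p m"
proof -
  note H = HomD[OF t] HomD[OF \<alpha>] and st = Comp_Hom[OF t s(2)] and s\<alpha> = Comp_Hom[OF \<alpha> s(2)]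
  note c = is_pullback_comm[OF pb, unfolded H]
  have "(s \<cdot> t) \<cdot> p = (s \<cdot> \<alpha>) \<cdot> m"
    using Comp_assoc[OF c(1) t s(2)] Comp_assoc[OF c(2) \<alpha> s(2)] c(3) by simp
  moreover have "\<exists>!h. h \<in> Hom C Y (Dom C p) \<and> p \<cdot> h = a \<and> m \<cdot> h = b"
    if a: "a \<in> Hom C Y L" and b: "b \<in> Hom C Y G" and eq: "(s \<cdot> t) \<cdot> a = (s \<cdot> \<alpha>) \<cdot> b" for Y a b
  proof (rule is_pullback_ex1[OF pb, unfolded H, OF a b])
    show "t \<cdot> a = \<alpha> \<cdot> b"
      using Comp_assoc[OF a t s(2)] Comp_assoc[OF b \<alpha> s(2)] eq
      by (intro monomorphism_cancel[OF s Comp_Hom[OF a t] Comp_Hom[OF b \<alpha>]]) simp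
  qed
  ultimately show ?thesis
    using c by (simp add: is_pullback_def HomD[OF st] HomD[OF s\<alpha>])
qed

lemma step_typing_unique:
  assumes T: "is_partial_map_classifier C {m. regular_mono C m} To Tm \<eta>"
    and rule: "is_pbpo_plus_rule C \<rho>" and cl: "classifying C To \<eta> \<rho>"
    and step: "is_pbpo_plus_step C \<rho> GL m \<alpha> GR" and step': "is_pbpo_plus_step C \<rho> GL m \<beta> GR'"
  shows "\<alpha> = \<beta>"
proof -
  have t: "typL \<rho> \<in> Hom C (objL \<rho>) (objL' \<rho>)" using rule by (simp add: is_pbpo_plus_rule_def)
  note H = HomD[OF t]
  have L: "objL \<rho> \<in> Obj C" using t Dom_Obj HomD by metis
  have m: "m \<in> Hom C (objL \<rho>) GL"
    and \<alpha>: "\<alpha> \<in> Hom C GL (objL' \<rho>)" and pb: "is_pullback C (typL \<rho>) \<alpha> (Ide C (objL \<rho>)) m"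
    and \<beta>: "\<beta> \<in> Hom C GL (objL' \<rho>)" and pb': "is_pullback C (typL \<rho>) \<beta> (Ide C (objL \<rho>)) m"
    using step step' by (auto simp: is_pbpo_plus_step_def)
  obtain s where s: "monomorphism C s" "s \<in> Hom C (objL' \<rho>) (To (objL \<rho>))"
    and st: "s \<cdot> typL \<rho> = \<eta> (objL \<rho>)" and reg: "regular_mono C (typL \<rho>)"
    using cl H by (auto simp: classifying_def restricted_classifier_def)
  \<comment> \<open>The classifier is applied to the span with legs \<open>m\<close> and the
    identity of \<open>objL \<rho>\<close>; both \<open>s \<cdot> \<alpha>\<close> and
    \<open>s \<cdot> \<beta>\<close> will be candidates for \<open>h\<close>.\<close>
  have "\<exists>!h. h \<in> Hom C GL (To (objL \<rho>)) \<and> is_pullback C (\<eta> (objL \<rho>)) h (Ide C (objL \<rho>)) m"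
    using T m Ide_Hom[OF L] regular_mono_pullback[OF pb reg]
    by (simp add: is_partial_map_classifier_def)
  then have "s \<cdot> \<alpha> = s \<cdot> \<beta>"
    using pullback_postcomp_mono[OF pb t \<alpha> s] pullback_postcomp_mono[OF pb' t \<beta> s]
      Comp_Hom[OF \<alpha> s(2)] Comp_Hom[OF \<beta> s(2)] st by auto
  then show ?thesis by (rule monomorphism_cancel[OF s \<alpha> \<beta>])
qed

text \<open>With a common \<open>\<alpha>\<close>, the two intermediate objects are pullbacks of one
  cospan. The comparison isomorphism also matches the arrows out of \<open>objK \<rho>\<close>, so
  both results become pushouts of the same span.\<close>

lemma step_result_unique:
  assumes step: "is_pbpo_plus_step C \<rho> GL m \<alpha> GR" and step': "is_pbpo_plus_step C \<rho> GL m \<alpha> GR'"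
  shows "isomorphic C GR GR'"
proof -
  obtain GK gL u' u gR w where
    1: "gL \<in> Hom C GK GL" "u' \<in> Hom C GK (objK' \<rho>)" "is_pullback C \<alpha> (arrl' \<rho>) gL u'"
      "u \<in> Hom C (objK \<rho>) GK" "u' \<cdot> u = typK \<rho>" "gR \<in> Hom C GK GR" "is_pushout C u (arrr \<rho>) gR w"
    using step unfolding is_pbpo_plus_step_def by blast
  obtain HK hL v' v hR x where
    2: "hL \<in> Hom C HK GL" "v' \<in> Hom C HK (objK' \<rho>)" "is_pullback C \<alpha> (arrl' \<rho>) hL v'"
      "\<forall>k \<in> Hom C (objK \<rho>) HK. v' \<cdot> k = typK \<rho> \<longrightarrow> k = v"
      "hR \<in> Hom C HK GR'" "is_pushout C v (arrr \<rho>) hR x"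
    using step' unfolding is_pbpo_plus_step_def by blast
  obtain \<phi> \<psi> where \<phi>: "\<phi> \<in> Hom C GK HK" "\<psi> \<in> Hom C HK GK"
    "\<psi> \<cdot> \<phi> = Ide C GK" "\<phi> \<cdot> \<psi> = Ide C HK" "v' \<cdot> \<phi> = u'"
    using pullback_iso[OF 1(3) 2(3), unfolded HomD[OF 1(1)] HomD[OF 2(1)]] by blast
  \<comment> \<open>Since \<open>v' \<cdot> (\<phi> \<cdot> u) = u' \<cdot> u = typK \<rho>\<close>,
    the uniqueness clause for \<open>v\<close> in the second step applies.\<close>
  have "\<phi> \<cdot> u = v"
    using 2(4) Comp_Hom[OF 1(4) \<phi>(1)] Comp_assoc[OF 1(4) \<phi>(1) 2(2)] \<phi>(5) 1(5) by simp
  then have "is_pushout C u (arrr \<rho>) (hR \<cdot> \<phi>) x"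
    using pushout_precomp_iso[OF _ \<phi>(1-4) 1(4)] 2(6) by simp
  from pushout_isomorphic[OF 1(7) this] show ?thesis
    by (simp add: HomD[OF 1(6)] HomD[OF Comp_Hom[OF \<phi>(1) 2(5)]])
qed

end

theorem theorem1:
  fixes C :: "('o, 'm) category_data"
    and To :: "'o \<Rightarrow> 'o" and Tm :: "'m \<Rightarrow> 'm" and \<eta> :: "'o \<Rightarrow> 'm"
    and \<rho> :: "('o, 'm) pbpo_rule"
    and GL GR GR' :: 'o and m \<alpha> \<beta> :: 'm
  assumes "quasitopos C"
    and "is_partial_map_classifier C {m. regular_mono C m} To Tm \<eta>"
    and "is_pbpo_plus_rule C \<rho>"
    and "classifying C To \<eta> \<rho>"
    and "is_pbpo_plus_step C \<rho> GL m \<alpha> GR"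
    and "is_pbpo_plus_step C \<rho> GL m \<beta> GR'"
  shows "\<alpha> = \<beta> \<and> isomorphic C GR GR'"
proof -
  interpret quasitopos C by fact
  \<comment> \<open>Once \<open>\<alpha> = \<beta>\<close> is known, the second step is also a step
    along \<open>\<alpha>\<close>, as \<open>step_result_unique\<close> requires.\<close>
  show ?thesis
    using step_typing_unique[OF assms(2-6)] step_result_unique assms(5,6) by blast
qed

end
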